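(* Let $(\Omega,\mathcal D,\mathbb E)$ be a sublinear expectation space over a measurable space $(\Omega,\mathcal F)$, and let $\theta:\Omega\to\Omega$ be a measurable expectation preserving transformation. Consider the statements: (i) Any invariant measurable set $B\in\mathcal F$ with respect to $\theta$ (i.e. $\theta^{-1}B=B$) satisfies either $\mathbb E[I_B]=0$ or $\mathbb E[I_{B^c}]=0$; (ii) If $B\in\mathcal F$ and $\mathbb E[I_{\theta^{-1}B\,\triangle\, B}]=0$, then either $\mathbb E[I_B]=0$ or $\mathbb E[I_{B^c}]=0$; (iii) For every $A\in\mathcal F$ with $\mathbb E[I_A]>0$, we have $\mathbb E\big[I_{(\bigcup_{n=1}^\infty\theta^{-n}A)^c}\big]=0$; (iv) For every $A,B\in\mathcal F$ with $\mathbb E[I_A]>0$ and $\mathbb E[I_B]>0$, there exists an integer $n\ge1$ such that $\mathbb E[I_{\theta^{-n}A\cap B}]>0$. Then (i) and (ii) are equivalent; (iii) implies (iv); and (iv) implies (i). Moreover, if $\mathbb E$ is regular, then (ii) implies (iii), and all four statements are equivalent.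
   Context: $(\Omega,\mathcal F)$ is a measurable space and $\mathcal D$ is the linear space of all $\mathcal F$-measurable real-valued functions on $\Omega$. A sublinear expectation is a functional $\mathbb E:\mathcal D\to\mathbb R$ that is monotone ($X\ge Y\Rightarrow\mathbb E[X]\ge\mathbb E[Y]$), constant preserving ($\mathbb E[c]=c$ for $c\in\mathbb R$), sub-additive ($\mathbb E[X+Y]\le\mathbb E[X]+\mathbb E[Y]$) and positively homogeneous ($\mathbb E[\lambda X]=\lambda\mathbb E[X]$ for $\lambda\ge0$). The triple $(\Omega,\mathcal D,\mathbb E)$ is a sublinear expectation space. A measurable map $\theta:\Omega\to\Omega$ is expectation preserving if $\mathbb E[X\circ\theta]=\mathbb E[X]$ for all $X\in\mathcal D$. $\mathbb E$ is regular if for any $A_n\in\mathcal F$ with $A_n\downarrow\emptyset$ we have $\mathbb E[I_{A_n}]\downarrow0$. $I_A$ is the indicator function of $A$ and $\triangle$ is the symmetric difference. *)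

theory Defs
  imports "HOL-Analysis.Analysis"
begin

text \<open>
  The measurable space is \<open>(space M, sets M)\<close>; the measure that the type \<open>'a measure\<close> also carries
  is never used. The space \<open>\<D>\<close> is \<open>borel_measurable M\<close>. Functions on \<open>\<Omega>\<close> are represented by total
  functions on \<open>'a\<close>: since the order is only required on \<open>space M\<close>, monotonicity forces \<open>E X\<close> to
  depend only on the restriction of \<open>X\<close> to \<open>space M\<close>.
\<close>

definition sublinear_expectation :: "'a measure \<Rightarrow> (('a \<Rightarrow> real) \<Rightarrow> real) \<Rightarrow> bool" where
  "sublinear_expectation M E \<longleftrightarrow>
     (\<forall>X\<in>borel_measurable M. \<forall>Y\<in>borel_measurable M.
        (\<forall>\<omega>\<in>space M. X \<omega> \<ge> Y \<omega>) \<longrightarrow> E X \<ge> E Y) \<and>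
     (\<forall>c. E (\<lambda>\<omega>. c) = c) \<and>
     (\<forall>X\<in>borel_measurable M. \<forall>Y\<in>borel_measurable M. E (\<lambda>\<omega>. X \<omega> + Y \<omega>) \<le> E X + E Y) \<and>
     (\<forall>X\<in>borel_measurable M. \<forall>l\<ge>0. E (\<lambda>\<omega>. l * X \<omega>) = l * E X)"

definition expectation_preserving ::
    "'a measure \<Rightarrow> (('a \<Rightarrow> real) \<Rightarrow> real) \<Rightarrow> ('a \<Rightarrow> 'a) \<Rightarrow> bool" where
  "expectation_preserving M E \<theta> \<longleftrightarrow>
     \<theta> \<in> measurable M M \<and> (\<forall>X\<in>borel_measurable M. E (X \<circ> \<theta>) = E X)"

definition regular_expectation :: "'a measure \<Rightarrow> (('a \<Rightarrow> real) \<Rightarrow> real) \<Rightarrow> bool" where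
  "regular_expectation M E \<longleftrightarrow>
     (\<forall>A :: nat \<Rightarrow> 'a set. range A \<subseteq> sets M \<longrightarrow> decseq A \<longrightarrow> (\<Inter>n. A n) = {} \<longrightarrow>
        decseq (\<lambda>n. E (indicator (A n))) \<and> (\<lambda>n. E (indicator (A n))) \<longlonglongrightarrow> 0)"

definition invariant_sets_trivial ::
    "'a measure \<Rightarrow> (('a \<Rightarrow> real) \<Rightarrow> real) \<Rightarrow> ('a \<Rightarrow> 'a) \<Rightarrow> bool" where
  "invariant_sets_trivial M E \<theta> \<longleftrightarrow>
     (\<forall>B\<in>sets M. \<theta> -` B \<inter> space M = B \<longrightarrow>
        E (indicator B) = 0 \<or> E (indicator (space M - B)) = 0)"

definition quasi_invariant_sets_trivial ::
    "'a measure \<Rightarrow> (('a \<Rightarrow> real) \<Rightarrow> real) \<Rightarrow> ('a \<Rightarrow> 'a) \<Rightarrow> bool" where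
  "quasi_invariant_sets_trivial M E \<theta> \<longleftrightarrow>
     (\<forall>B\<in>sets M. E (indicator (sym_diff (\<theta> -` B \<inter> space M) B)) = 0 \<longrightarrow>
        E (indicator B) = 0 \<or> E (indicator (space M - B)) = 0)"

definition preimages_exhaust ::
    "'a measure \<Rightarrow> (('a \<Rightarrow> real) \<Rightarrow> real) \<Rightarrow> ('a \<Rightarrow> 'a) \<Rightarrow> bool" where
  "preimages_exhaust M E \<theta> \<longleftrightarrow>
     (\<forall>A\<in>sets M. E (indicator A) > 0 \<longrightarrow>
        E (indicator (space M - (\<Union>n\<in>{1..}. (\<theta> ^^ n) -` A \<inter> space M))) = 0)"

definition preimages_meet ::
    "'a measure \<Rightarrow> (('a \<Rightarrow> real) \<Rightarrow> real) \<Rightarrow> ('a \<Rightarrow> 'a) \<Rightarrow> bool" where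
  "preimages_meet M E \<theta> \<longleftrightarrow>
     (\<forall>A\<in>sets M. \<forall>B\<in>sets M. E (indicator A) > 0 \<longrightarrow> E (indicator B) > 0 \<longrightarrow>
        (\<exists>n\<ge>1. E (indicator (((\<theta> ^^ n) -` A \<inter> space M) \<inter> B)) > 0))"

end

theory Submission
  imports Defs
begin

text \<open>
  Because \<open>E\<close> is real-valued on all measurable functions, unbounded ones included, it is
  automatically regular: if \<open>A n\<close> decreases to \<open>{}\<close>, then \<open>X = (\<Sum>n. indicator (A n))\<close> is finite
  everywhere and \<open>n * E (indicator (A n)) \<le> E X\<close>. Hence countable unions of null sets are null even
  without a regularity assumption, and the classical arguments apply, with the invariant set of
  points that visit a given set infinitely often.
\<close>

section \<open>Sublinear expectations, their capacities and null sets\<close>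

locale sublinear_expectation_space =
  fixes M :: "'a measure" and E :: "('a \<Rightarrow> real) \<Rightarrow> real"
  assumes sublinear: "sublinear_expectation M E"
begin

lemma E_mono:
  assumes "X \<in> borel_measurable M" "Y \<in> borel_measurable M"
    and "\<And>\<omega>. \<omega> \<in> space M \<Longrightarrow> X \<omega> \<le> Y \<omega>"
  shows "E X \<le> E Y"
  using sublinear assms unfolding sublinear_expectation_def by blast

lemma E_const: "E (\<lambda>\<omega>. c) = c"
  using sublinear unfolding sublinear_expectation_def by blast

lemma E_add:
  assumes "X \<in> borel_measurable M" "Y \<in> borel_measurable M"
  shows "E (\<lambda>\<omega>. X \<omega> + Y \<omega>) \<le> E X + E Y"
  using sublinear assms unfolding sublinear_expectation_def by blast

lemma E_scale:
  assumes "X \<in> borel_measurable M" "l \<ge> 0"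
  shows "E (\<lambda>\<omega>. l * X \<omega>) = l * E X"
  using sublinear assms unfolding sublinear_expectation_def by blast

text \<open>The upper probability induced by \<open>E\<close>. In general it is subadditive but not
  additive, so a set and its complement have to be treated separately throughout.\<close>

definition capacity :: "'a set \<Rightarrow> real" where
  "capacity A = E (indicator A)"

lemma capacity_empty [simp]: "capacity {} = 0"
proof -
  have "indicator ({} :: 'a set) = (\<lambda>\<omega>. 0 :: real)"
    by (simp add: fun_eq_iff)
  then show ?thesis
    unfolding capacity_def by (simp only: E_const)
qed

lemma capacity_mono:
  assumes "A \<in> sets M" "B \<in> sets M" "A \<subseteq> B"
  shows "capacity A \<le> capacity B"
  unfolding capacity_def using assms
  by (intro E_mono) (auto simp: indicator_def)

lemma capacity_nonneg:
  assumes "A \<in> sets M"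
  shows "0 \<le> capacity A"
  using capacity_mono[of "{}" A] assms by simp

lemma capacity_Un:
  assumes "A \<in> sets M" "B \<in> sets M"
  shows "capacity (A \<union> B) \<le> capacity A + capacity B"
proof -
  have "capacity (A \<union> B) \<le> E (\<lambda>\<omega>. indicator A \<omega> + indicator B \<omega>)"
    unfolding capacity_def using assms
    by (intro E_mono) (auto simp: indicator_def)
  also have "\<dots> \<le> capacity A + capacity B"
    unfolding capacity_def using assms by (intro E_add) auto
  finally show ?thesis .
qed

lemma capacity_subadditive:
  assumes "A \<in> sets M" "B \<in> sets M" "C \<in> sets M" "A \<subseteq> B \<union> C"
  shows "capacity A \<le> capacity B + capacity C"
  using capacity_mono[of A "B \<union> C"] capacity_Un[of B C] assms by auto

lemma null_subset_Un:
  assumes "A \<in> sets M" "B \<in> sets M" "C \<in> sets M" "A \<subseteq> B \<union> C"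
    and "capacity B = 0" "capacity C = 0"
  shows "capacity A = 0"
  using capacity_subadditive[OF assms(1-4)] capacity_nonneg[OF assms(1)] assms(5,6) by simp

lemma null_subset:
  assumes "A \<subseteq> B" "capacity B = 0" "A \<in> sets M" "B \<in> sets M"
  shows "capacity A = 0"
  using null_subset_Un[of A B "{}"] assms by simp

section \<open>Regularity and countable unions of null sets\<close>

lemma capacity_regular:
  fixes A :: "nat \<Rightarrow> 'a set"
  assumes A: "\<And>n. A n \<in> sets M" and dec: "decseq A" and empty: "(\<Inter>n. A n) = {}"
  shows "(\<lambda>n. capacity (A n)) \<longlonglongrightarrow> 0"
proof -
  define X where "X \<omega> = (\<Sum>n. indicator (A n) \<omega> :: real)" for \<omega>
  have X [measurable]: "X \<in> borel_measurable M"
    unfolding X_def using A by measurable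
  have "real n * indicator (A n) \<omega> \<le> X \<omega>" for n \<omega>
  proof -
    \<comment> \<open>The point leaves the decreasing sequence at \<open>N\<close> and never
      returns, so its series has finitely many nonzero terms.\<close>
    obtain N where "\<omega> \<notin> A N"
      using empty by auto
    then have "\<omega> \<notin> A m" if "m \<ge> N" for m
      using decseqD[OF dec that] by auto
    then have summ: "summable (\<lambda>n. indicator (A n) \<omega> :: real)"
      by (intro summable_finite[of "{..<N}"]) (auto simp: not_less)
    \<comment> \<open>A point of \<open>A n\<close> lies in every earlier \<open>A k\<close> too, so
      the first \<open>n\<close> terms of the series already sum to \<open>n\<close> there.\<close>
    have "real n * indicator (A n) \<omega> = (\<Sum>k<n. indicator (A n) \<omega>)"
      by simp
    also have "\<dots> \<le> (\<Sum>k<n. indicator (A k) \<omega>)"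
      using decseqD[OF dec less_imp_le] by (intro sum_mono) (auto simp: indicator_def)
    also have "\<dots> \<le> X \<omega>"
      unfolding X_def by (rule sum_le_suminf[OF summ]) auto
    finally show ?thesis .
  qed
  then have "E (\<lambda>\<omega>. real n * indicator (A n) \<omega>) \<le> E X" for n
    using A by (intro E_mono) auto
  then have bound: "real n * capacity (A n) \<le> E X" for n
    using A by (simp add: E_scale capacity_def)
  show ?thesis
  proof (rule tendsto_sandwich[where f = "\<lambda>_. 0" and h = "\<lambda>n. E X / real n"])
    show "(\<lambda>n. E X / real n) \<longlonglongrightarrow> 0"
      by (rule lim_const_over_n)
    \<comment> \<open>Dividing \<open>bound\<close> by \<open>n\<close> requires
      \<open>n > 0\<close>: at \<open>n = 0\<close> the quotient is 0 by convention, while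
      \<open>capacity (A 0)\<close> may be positive.\<close>
    show "\<forall>\<^sub>F n in sequentially. capacity (A n) \<le> E X / real n"
      using eventually_gt_at_top[of 0] by eventually_elim
        (use bound in \<open>simp add: field_simps\<close>)
    show "\<forall>\<^sub>F n in sequentially. 0 \<le> capacity (A n)"
      using A by (simp add: capacity_nonneg)
  qed simp
qed

text \<open>Subadditivity handles finite unions. What remains of the union after removing the first
  \<open>n\<close> sets decreases to the empty set, so \<open>capacity_regular\<close> handles the
  limit.\<close>

lemma null_UN:
  fixes N :: "nat \<Rightarrow> 'a set"
  assumes N: "\<And>n. N n \<in> sets M" and null: "\<And>n. capacity (N n) = 0"
  shows "capacity (\<Union>n. N n) = 0"
proof -
  have fin: "capacity (\<Union>k<n. N k) = 0" for n
  proof (induction n)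
    case (Suc n)
    show ?case
      by (rule null_subset_Un[of _ "\<Union>k<n. N k" "N n"])
        (use N null Suc in \<open>auto simp: less_Suc_eq\<close>)
  qed simp
  define D where "D n = (\<Union>k. N k) - (\<Union>k<n. N k)" for n
  have D: "D n \<in> sets M" for n
    unfolding D_def using N by auto
  have "capacity (\<Union>k. N k) \<le> capacity (D n)" for n
    using capacity_subadditive[of "\<Union>k. N k" "\<Union>k<n. N k" "D n"] fin[of n] N D
    by (auto simp: D_def)
  moreover have "(\<lambda>n. capacity (D n)) \<longlonglongrightarrow> 0"
  proof (rule capacity_regular[OF D])
    show "decseq D"
      unfolding decseq_def D_def by auto
    show "(\<Inter>n. D n) = {}"
      unfolding D_def by blast
  qed
  ultimately have "capacity (\<Union>k. N k) \<le> 0"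
    by (intro LIMSEQ_le_const) auto
  then show ?thesis
    using capacity_nonneg[of "\<Union>k. N k"] N by auto
qed

end

section \<open>Expectation preserving maps and preimages under their iterates\<close>

locale expectation_preserving_system = sublinear_expectation_space +
  fixes \<theta> :: "'a \<Rightarrow> 'a"
  assumes preserving: "expectation_preserving M E \<theta>"
begin

lemma measurable_theta [measurable]: "\<theta> \<in> measurable M M"
  using preserving unfolding expectation_preserving_def by blast

lemma measurable_funpow_theta [measurable]: "\<theta> ^^ n \<in> measurable M M"
proof (induction n)
  case (Suc n)
  then show ?case
    using measurable_comp[OF Suc.IH measurable_theta] by simp
qed simp

lemma funpow_theta_space: "\<omega> \<in> space M \<Longrightarrow> (\<theta> ^^ n) \<omega> \<in> space M"
  using measurable_space[OF measurable_funpow_theta] .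

lemma E_funpow: "X \<in> borel_measurable M \<Longrightarrow> E (X \<circ> \<theta> ^^ n) = E X"
proof (induction n)
  case (Suc n)
  have "X \<circ> \<theta> ^^ n \<in> borel_measurable M"
    using Suc.prems by (intro measurable_comp[OF measurable_funpow_theta])
  then have "E ((X \<circ> \<theta> ^^ n) \<circ> \<theta>) = E X"
    using preserving Suc.IH[OF Suc.prems] unfolding expectation_preserving_def by (metis (no_types))
  then show ?case
    by (simp only: funpow_Suc_right o_assoc)
qed simp

definition pre :: "nat \<Rightarrow> 'a set \<Rightarrow> 'a set" where
  "pre n A = (\<theta> ^^ n) -` A \<inter> space M"

lemma pre_sets [measurable]: "A \<in> sets M \<Longrightarrow> pre n A \<in> sets M"
  unfolding pre_def by (rule measurable_sets[OF measurable_funpow_theta])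

lemma in_pre: "\<omega> \<in> pre n A \<longleftrightarrow> \<omega> \<in> space M \<and> (\<theta> ^^ n) \<omega> \<in> A"
  by (auto simp: pre_def)

lemma capacity_pre:
  assumes "A \<in> sets M"
  shows "capacity (pre n A) = capacity A"
proof -
  \<comment> \<open>The two functions agree on \<open>space M\<close> but may differ outside it, so
    monotonicity is used in both directions.\<close>
  have "capacity (pre n A) = E (indicator A \<circ> \<theta> ^^ n)"
    unfolding capacity_def using assms
    by (intro antisym E_mono measurable_comp[OF measurable_funpow_theta])
      (auto simp: indicator_def in_pre)
  also have "\<dots> = capacity A"
    unfolding capacity_def using assms by (intro E_funpow) auto
  finally show ?thesis .
qed

section \<open>Points visiting a set infinitely often: the limit superior of its preimages\<close>

definition recurrent_set :: "'a set \<Rightarrow> 'a set" where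
  "recurrent_set A = (\<Inter>m. \<Union>n\<in>{m..}. pre n A)"

lemma recurrent_set_sets: "A \<in> sets M \<Longrightarrow> recurrent_set A \<in> sets M"
  unfolding recurrent_set_def by measurable

lemma in_recurrent_set:
  "\<omega> \<in> recurrent_set A \<longleftrightarrow> \<omega> \<in> space M \<and> (\<forall>m. \<exists>n\<ge>m. (\<theta> ^^ n) \<omega> \<in> A)"
  by (auto simp: recurrent_set_def in_pre)

text \<open>Applying \<open>\<theta>\<close> shifts the orbit by one step, and visiting infinitely
  often depends only on the tail of the orbit. The invariance is therefore exact, not merely up to a
  null set.\<close>

lemma recurrent_set_invariant: "\<theta> -` recurrent_set A \<inter> space M = recurrent_set A"
proof (intro set_eqI iffI)
  fix \<omega> assume *: "\<omega> \<in> \<theta> -` recurrent_set A \<inter> space M"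
  have "\<exists>n\<ge>m. (\<theta> ^^ n) \<omega> \<in> A" for m
  proof -
    from * obtain n where "n \<ge> m" "(\<theta> ^^ n) (\<theta> \<omega>) \<in> A"
      by (auto simp: in_recurrent_set)
    then show ?thesis
      by (intro exI[of _ "Suc n"]) (simp add: funpow_swap1)
  qed
  with * show "\<omega> \<in> recurrent_set A"
    by (auto simp: in_recurrent_set)
next
  fix \<omega> assume *: "\<omega> \<in> recurrent_set A"
  have "\<exists>n\<ge>m. (\<theta> ^^ n) (\<theta> \<omega>) \<in> A" for m
  proof -
    \<comment> \<open>Asking for a time beyond \<open>Suc m\<close> keeps \<open>n\<close> positive
      and \<open>n - 1 \<ge> m\<close> after the shift.\<close>
    from * obtain n where "n \<ge> Suc m" "(\<theta> ^^ n) \<omega> \<in> A"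
      unfolding in_recurrent_set by blast
    then show ?thesis
      by (intro exI[of _ "n - 1"]) (cases n; simp add: funpow_swap1)
  qed
  with * show "\<omega> \<in> \<theta> -` recurrent_set A \<inter> space M"
    using funpow_theta_space[of \<omega> 1] by (auto simp: in_recurrent_set)
qed

text \<open>If the orbit never meets the symmetric difference, membership in \<open>B\<close> is
  constant along it, so infinitely many visits to \<open>B\<close> amount to starting in
  \<open>B\<close>. The exceptional points form a countable union of preimages of a null
  set.\<close>

lemma recurrent_set_quasi_invariant:
  assumes B: "B \<in> sets M" and null: "capacity (sym_diff (pre 1 B) B) = 0"
  shows "capacity (sym_diff (recurrent_set B) B) = 0"
proof -
  let ?S = "sym_diff (pre 1 B) B"
  have S: "?S \<in> sets M"
    using B by auto
  have "sym_diff (recurrent_set B) B \<subseteq> (\<Union>n. pre n ?S)"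
  proof
    fix \<omega> assume *: "\<omega> \<in> sym_diff (recurrent_set B) B"
    then have \<omega>: "\<omega> \<in> space M"
      using sets.sets_into_space[OF B] by (auto simp: in_recurrent_set)
    show "\<omega> \<in> (\<Union>n. pre n ?S)"
    proof (rule ccontr)
      assume "\<omega> \<notin> (\<Union>n. pre n ?S)"
      then have step: "(\<theta> ^^ Suc n) \<omega> \<in> B \<longleftrightarrow> (\<theta> ^^ n) \<omega> \<in> B" for n
        using \<omega> funpow_theta_space[OF \<omega>, of n] by (auto simp: in_pre)
      have "(\<theta> ^^ n) \<omega> \<in> B \<longleftrightarrow> \<omega> \<in> B" for n
        by (induction n) (use step in auto)
      with * \<omega> show False
        by (auto simp: in_recurrent_set)
    qed
  qed
  moreover have "capacity (\<Union>n. pre n ?S) = 0"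
    by (rule null_UN) (use S null in \<open>auto simp: capacity_pre\<close>)
  ultimately show ?thesis
    by (rule null_subset) (use S B recurrent_set_sets[OF B] in auto)
qed

text \<open>The sets \<open>U m\<close> decrease to \<open>recurrent_set A\<close>, and each
  contains a preimage of \<open>A\<close>, whose capacity equals that of \<open>A\<close>. This
  lower bound survives the limit.\<close>

lemma recurrent_set_not_null:
  assumes A: "A \<in> sets M" and pos: "capacity A > 0"
  shows "capacity (recurrent_set A) > 0"
proof -
  define U where "U m = (\<Union>n\<in>{m..}. pre n A)" for m
  have U: "U m \<in> sets M" for m
    unfolding U_def using A by auto
  let ?C = "recurrent_set A"
  have C: "?C \<in> sets M"
    by (rule recurrent_set_sets[OF A])
  have "capacity A \<le> capacity (U m)" for m
    using capacity_mono[of "pre m A" "U m"] capacity_pre[OF A, of m] A U by (auto simp: U_def)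
  also have "capacity (U m) \<le> capacity ?C + capacity (U m - ?C)" for m
    by (rule capacity_subadditive) (use U C in auto)
  finally have "capacity A \<le> capacity ?C + capacity (U m - ?C)" for m .
  \<comment> \<open>\<open>capacity_regular\<close> concerns sequences decreasing to the empty set;
    removing the limit \<open>?C\<close> by subadditivity brings the sequence into that
    form.\<close>
  moreover have "(\<lambda>m. capacity ?C + capacity (U m - ?C)) \<longlonglongrightarrow> capacity ?C + 0"
  proof (intro tendsto_add tendsto_const capacity_regular)
    show "U m - ?C \<in> sets M" for m
      using U C by auto
    show "decseq (\<lambda>m. U m - ?C)"
      unfolding decseq_def U_def by (intro allI impI Diff_mono UN_mono) auto
    show "(\<Inter>m. U m - ?C) = {}"
      unfolding U_def recurrent_set_def by blast
  qed
  ultimately have "capacity A \<le> capacity ?C"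
    by (intro LIMSEQ_le_const) auto
  with pos show ?thesis
    by simp
qed

section \<open>Implications among the four ergodicity conditions\<close>

lemma invariant_sets_trivial_iff:
  "invariant_sets_trivial M E \<theta> \<longleftrightarrow>
     (\<forall>B\<in>sets M. pre 1 B = B \<longrightarrow> capacity B = 0 \<or> capacity (space M - B) = 0)"
  by (simp add: invariant_sets_trivial_def capacity_def pre_def)

lemma quasi_invariant_sets_trivial_iff:
  "quasi_invariant_sets_trivial M E \<theta> \<longleftrightarrow>
     (\<forall>B\<in>sets M. capacity (sym_diff (pre 1 B) B) = 0 \<longrightarrow>
        capacity B = 0 \<or> capacity (space M - B) = 0)"
  by (simp add: quasi_invariant_sets_trivial_def capacity_def pre_def)

lemma preimages_exhaust_iff:
  "preimages_exhaust M E \<theta> \<longleftrightarrow>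
     (\<forall>A\<in>sets M. capacity A > 0 \<longrightarrow> capacity (space M - (\<Union>n\<in>{1..}. pre n A)) = 0)"
  by (simp add: preimages_exhaust_def capacity_def pre_def)

lemma preimages_meet_iff:
  "preimages_meet M E \<theta> \<longleftrightarrow>
     (\<forall>A\<in>sets M. \<forall>B\<in>sets M. capacity A > 0 \<longrightarrow> capacity B > 0 \<longrightarrow>
        (\<exists>n\<ge>1. capacity (pre n A \<inter> B) > 0))"
  by (simp add: preimages_meet_def capacity_def pre_def)

lemma recurrent_set_trivial:
  assumes "invariant_sets_trivial M E \<theta>" "A \<in> sets M"
  shows "capacity (recurrent_set A) = 0 \<or> capacity (space M - recurrent_set A) = 0"
  using assms(1) recurrent_set_sets[OF assms(2)] recurrent_set_invariant[of A]
  unfolding invariant_sets_trivial_def capacity_def by blast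

text \<open>The exactly invariant set \<open>recurrent_set B\<close> differs from \<open>B\<close>
  by a null set, so whichever alternative holds for it passes to \<open>B\<close>.\<close>

lemma invariant_imp_quasi_invariant:
  assumes "invariant_sets_trivial M E \<theta>"
  shows "quasi_invariant_sets_trivial M E \<theta>"
  unfolding quasi_invariant_sets_trivial_iff
proof (intro ballI impI)
  fix B assume B: "B \<in> sets M" and "capacity (sym_diff (pre 1 B) B) = 0"
  then have diff: "capacity (sym_diff (recurrent_set B) B) = 0"
    by (rule recurrent_set_quasi_invariant)
  have C: "recurrent_set B \<in> sets M"
    by (rule recurrent_set_sets[OF B])
  from recurrent_set_trivial[OF assms B]
  show "capacity B = 0 \<or> capacity (space M - B) = 0"
  proof
    assume "capacity (recurrent_set B) = 0"
    then have "capacity B = 0"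
      using B C diff
      by (intro null_subset_Un[of B "recurrent_set B" "sym_diff (recurrent_set B) B"]) auto
    then show ?thesis ..
  next
    assume "capacity (space M - recurrent_set B) = 0"
    then have "capacity (space M - B) = 0"
      using B C diff
      by (intro null_subset_Un[of "space M - B" "space M - recurrent_set B"
            "sym_diff (recurrent_set B) B"]) auto
    then show ?thesis ..
  qed
qed

lemma quasi_invariant_imp_invariant:
  assumes "quasi_invariant_sets_trivial M E \<theta>"
  shows "invariant_sets_trivial M E \<theta>"
  using assms unfolding quasi_invariant_sets_trivial_iff invariant_sets_trivial_iff by simp

text \<open>Positive capacity of \<open>A\<close> rules out the first alternative for
  \<open>recurrent_set A\<close>. Hence, off a null set, every point visits \<open>A\<close>
  infinitely often, in particular at some time \<open>n \<ge> 1\<close>.\<close>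

lemma invariant_imp_exhaust:
  assumes "invariant_sets_trivial M E \<theta>"
  shows "preimages_exhaust M E \<theta>"
  unfolding preimages_exhaust_iff
proof (intro ballI impI)
  fix A assume A: "A \<in> sets M" and "capacity A > 0"
  then have null: "capacity (space M - recurrent_set A) = 0"
    using recurrent_set_trivial[OF assms A] recurrent_set_not_null[OF A] by auto
  have "space M - (\<Union>n\<in>{1..}. pre n A) \<subseteq> space M - recurrent_set A"
    unfolding recurrent_set_def by blast
  from this null show "capacity (space M - (\<Union>n\<in>{1..}. pre n A)) = 0"
    by (rule null_subset) (use A recurrent_set_sets[OF A] in auto)
qed

text \<open>Otherwise \<open>B\<close> would be covered by two null sets: the points that never
  visit \<open>A\<close> at a positive time, and the countable union of the null sets
  \<open>pre n A \<inter> B\<close>.\<close>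

lemma exhaust_imp_meet:
  assumes "preimages_exhaust M E \<theta>"
  shows "preimages_meet M E \<theta>"
  unfolding preimages_meet_iff
proof (intro ballI impI, rule ccontr)
  fix A B assume A: "A \<in> sets M" and B: "B \<in> sets M"
    and pos: "capacity A > 0" "capacity B > 0"
    and "\<not> (\<exists>n\<ge>1. capacity (pre n A \<inter> B) > 0)"
  then have "capacity (pre (Suc n) A \<inter> B) \<le> 0" for n
    by (simp add: not_less)
  moreover have "capacity (pre (Suc n) A \<inter> B) \<ge> 0" for n
    using A B by (intro capacity_nonneg) auto
  ultimately have "capacity (pre (Suc n) A \<inter> B) = 0" for n
    by (rule antisym)
  \<comment> \<open>Indexing by \<open>Suc n\<close> turns the times from 1 onwards into a sequence
    over all naturals, as \<open>null_UN\<close> expects.\<close>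
  then have "capacity (\<Union>n. pre (Suc n) A \<inter> B) = 0"
    using A B by (intro null_UN) auto
  moreover have "capacity (space M - (\<Union>n\<in>{1..}. pre n A)) = 0"
    using assms A pos unfolding preimages_exhaust_iff by blast
  moreover have "B \<subseteq> (space M - (\<Union>n\<in>{1..}. pre n A)) \<union> (\<Union>n. pre (Suc n) A \<inter> B)"
  proof
    fix \<omega> assume \<omega>: "\<omega> \<in> B"
    have "\<exists>k. \<omega> \<in> pre (Suc k) A" if "\<omega> \<in> pre n A" "n \<ge> 1" for n
      using that by (intro exI[of _ "n - 1"]) simp
    then show "\<omega> \<in> (space M - (\<Union>n\<in>{1..}. pre n A)) \<union> (\<Union>n. pre (Suc n) A \<inter> B)"
      using \<omega> sets.sets_into_space[OF B] by blast
  qed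
  ultimately have "capacity B = 0"
    using A B
      by (intro null_subset_Un[of B "space M - (\<Union>n\<in>{1..}. pre n A)"
          "\<Union>n. pre (Suc n) A \<inter> B"]) auto
  with pos show False
    by simp
qed

text \<open>A nontrivial invariant set and its complement would both have positive capacity, yet no
  preimage of the set meets the complement.\<close>

lemma meet_imp_invariant:
  assumes "preimages_meet M E \<theta>"
  shows "invariant_sets_trivial M E \<theta>"
  unfolding invariant_sets_trivial_iff
proof (intro ballI impI, rule ccontr)
  fix B assume B: "B \<in> sets M" and inv: "pre 1 B = B"
    and "\<not> (capacity B = 0 \<or> capacity (space M - B) = 0)"
  then have "capacity B > 0" "capacity (space M - B) > 0"
    using capacity_nonneg[of B] capacity_nonneg[of "space M - B"] by auto
  then obtain n where n: "capacity (pre n B \<inter> (space M - B)) > 0"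
    using assms B unfolding preimages_meet_iff by blast
  have "\<omega> \<in> B \<longleftrightarrow> \<theta> \<omega> \<in> B" if "\<omega> \<in> space M" for \<omega>
    using inv that by (auto simp: pre_def)
  then have "(\<theta> ^^ n) \<omega> \<in> B \<longleftrightarrow> \<omega> \<in> B" if "\<omega> \<in> space M" for \<omega>
    using that by (induction n) (auto simp: funpow_theta_space)
  then have "pre n B \<inter> (space M - B) = {}"
    by (auto simp: in_pre)
  with n show False
    by simp
qed

end

theorem theorem2p4:
  fixes M :: "'a measure"
    and E :: "('a \<Rightarrow> real) \<Rightarrow> real"
    and \<theta> :: "'a \<Rightarrow> 'a"
  assumes "sublinear_expectation M E"
    and "expectation_preserving M E \<theta>"
  shows "(invariant_sets_trivial M E \<theta> \<longleftrightarrow> quasi_invariant_sets_trivial M E \<theta>) \<and>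
    (preimages_exhaust M E \<theta> \<longrightarrow> preimages_meet M E \<theta>) \<and>
    (preimages_meet M E \<theta> \<longrightarrow> invariant_sets_trivial M E \<theta>) \<and>
    (regular_expectation M E \<longrightarrow>
      (quasi_invariant_sets_trivial M E \<theta> \<longrightarrow> preimages_exhaust M E \<theta>) \<and>
      (invariant_sets_trivial M E \<theta> \<longleftrightarrow> quasi_invariant_sets_trivial M E \<theta>) \<and>
      (quasi_invariant_sets_trivial M E \<theta> \<longleftrightarrow> preimages_exhaust M E \<theta>) \<and>
      (preimages_exhaust M E \<theta> \<longleftrightarrow> preimages_meet M E \<theta>))"
proof -
  interpret expectation_preserving_system M E \<theta>
    using assms by unfold_locales
  \<comment> \<open>Invariant sets, exhaustion and meeting form a cycle of implications; the
    quasi-invariant condition is attached to it by the first equivalence.\<close>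
  show ?thesis
    using invariant_imp_quasi_invariant quasi_invariant_imp_invariant
      invariant_imp_exhaust exhaust_imp_meet meet_imp_invariant by blast
qed

end
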